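(* Let $T$ be a subresiduated Nelson algebra. The assignments $\theta\mapsto 1/\theta$ (the equivalence class of $1$) and $F\mapsto\Theta(F)=\{(x,y)\in T\times T: s(x,y)\in F\}$ establish an order isomorphism between the set $\mathrm{Con}(T)$ of congruences of $T$ and the set $\mathrm{IF}^{o}(T)$ of open implicative filters of $T$, both ordered by inclusion.
   Context: A Kleene algebra is a bounded distributive lattice $\langle T,\wedge,\vee,0,1\rangle$ with a unary operation $\sim$ satisfying $\sim\sim x=x$, $\sim(x\wedge y)=\sim x\vee\sim y$, $(x\wedge\sim x)\wedge(y\vee\sim y)=x\wedge\sim x$. A subresiduated Nelson algebra is an algebra $\langle T,\wedge,\vee,\to,\sim,0,1\rangle$ of type $(2,2,2,1,0,0)$ such that $\langle T,\wedge,\vee,\sim,0,1\rangle$ is a Kleene algebra and for all $x,y,z\in T$: (1) $(x\vee y)\to z=(x\to z)\wedge(y\to z)$; (2) $z\to(x\wedge y)=(z\to x)\wedge(z\to y)$; (3) $((x\to y)\wedge(y\to z))\to(x\to z)=1$; (4) $x\to x=1$; (5) $x\wedge(x\to y)\le x\wedge(\sim x\vee y)$; (6) $x\to y\le z\to(x\to y)$; (7) $\sim(x\to y)\to(x\wedge\sim y)=1$; (8) $(x\wedge\sim y)\to\sim(x\to y)=1$. A subset $F\subseteq T$ is an implicative filter if $1\in F$ and for all $x,y\in T$, if $x\in F$ and $x\to y\in F$ then $y\in F$. It is an open implicative filter if in addition $1\to x\in F$ for every $x\in F$. For $x,y\in T$, $s(x,y)=(x\to y)\wedge(y\to x)\wedge(\sim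 x\to\sim y)\wedge(\sim y\to\sim x)$. *)

theory Defs
  imports Main
begin

unbundle lattice_syntax

text \<open>The carrier of an algebra is the whole (arbitrary, nonempty) type; the constants
  \<open>0\<close> and \<open>1\<close> are \<^term>\<open>bot\<close> and \<^term>\<open>top\<close>, and the one-element algebra is allowed.\<close>

class kleene_algebra = distrib_lattice + bounded_lattice +
  fixes kneg :: "'a \<Rightarrow> 'a"  (\<open>\<sim> _\<close> [80] 80)
  assumes kneg_kneg: "\<sim> \<sim> x = x"
    and kneg_inf: "\<sim> (x \<sqinter> y) = \<sim> x \<squnion> \<sim> y"
    and kleene: "(x \<sqinter> \<sim> x) \<sqinter> (y \<squnion> \<sim> y) = x \<sqinter> \<sim> x"

class subresiduated_nelson_algebra = kleene_algebra +
  fixes nimp :: "'a \<Rightarrow> 'a \<Rightarrow> 'a"  (infixr \<open>\<rightarrow>\<close> 60)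
  assumes sup_nimp: "((x \<squnion> y) \<rightarrow> z) = (x \<rightarrow> z) \<sqinter> (y \<rightarrow> z)"
    and nimp_inf: "(z \<rightarrow> (x \<sqinter> y)) = (z \<rightarrow> x) \<sqinter> (z \<rightarrow> y)"
    and nimp_trans: "(((x \<rightarrow> y) \<sqinter> (y \<rightarrow> z)) \<rightarrow> (x \<rightarrow> z)) = \<top>"
    and nimp_refl: "(x \<rightarrow> x) = \<top>"
    and inf_nimp_le: "x \<sqinter> (x \<rightarrow> y) \<le> x \<sqinter> (\<sim> x \<squnion> y)"
    and nimp_le_nimp: "(x \<rightarrow> y) \<le> (z \<rightarrow> (x \<rightarrow> y))"
    and kneg_nimp_1: "(\<sim> (x \<rightarrow> y) \<rightarrow> (x \<sqinter> \<sim> y)) = \<top>"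
    and kneg_nimp_2: "((x \<sqinter> \<sim> y) \<rightarrow> \<sim> (x \<rightarrow> y)) = \<top>"

definition implicative_filter :: "'a::subresiduated_nelson_algebra set \<Rightarrow> bool" where
  "implicative_filter F \<longleftrightarrow>
     \<top> \<in> F \<and> (\<forall>x y. x \<in> F \<longrightarrow> (x \<rightarrow> y) \<in> F \<longrightarrow> y \<in> F)"

definition open_implicative_filters :: "'a::subresiduated_nelson_algebra set set" where
  "open_implicative_filters = {F. implicative_filter F \<and> (\<forall>x\<in>F. (\<top> \<rightarrow> x) \<in> F)}"

definition congruences :: "('a::subresiduated_nelson_algebra \<times> 'a) set set" where
  "congruences = {\<theta>. equiv UNIV \<theta> \<and>
     (\<forall>x x' y y'. (x, x') \<in> \<theta> \<longrightarrow> (y, y') \<in> \<theta> \<longrightarrow>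
        (x \<sqinter> y, x' \<sqinter> y') \<in> \<theta> \<and> (x \<squnion> y, x' \<squnion> y') \<in> \<theta> \<and> (x \<rightarrow> y, x' \<rightarrow> y') \<in> \<theta>) \<and>
     (\<forall>x x'. (x, x') \<in> \<theta> \<longrightarrow> (\<sim> x, \<sim> x') \<in> \<theta>)}"

definition class_of_one :: "('a::subresiduated_nelson_algebra \<times> 'a) set \<Rightarrow> 'a set" where
  "class_of_one \<theta> = \<theta> `` {\<top>}"

definition s_term :: "'a::subresiduated_nelson_algebra \<Rightarrow> 'a \<Rightarrow> 'a" where
  "s_term x y = (x \<rightarrow> y) \<sqinter> (y \<rightarrow> x) \<sqinter> (\<sim> x \<rightarrow> \<sim> y) \<sqinter> (\<sim> y \<rightarrow> \<sim> x)"

definition Theta :: "'a::subresiduated_nelson_algebra set \<Rightarrow> ('a \<times> 'a) set" where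
  "Theta F = {(x, y). s_term x y \<in> F}"

end

theory Submission
  imports Defs
begin

text \<open>
  Write \<open>x \<preceq> y\<close> for \<open>(x \<rightarrow> y) = \<top>\<close>. This is a preorder containing \<open>\<le>\<close>, but it is weaker than
  \<open>\<le>\<close>: the implication alone does not see the whole lattice order. The order is recovered from the
  implication together with the negation, since the Kleene law gives
  \<open>x \<le> y\<close> if and only if \<open>x \<preceq> y\<close> and \<open>\<sim> y \<preceq> \<sim> x\<close>. This is why the term \<open>s_term\<close> has four factors:
  \<open>s_term x y = \<top>\<close> if and only if \<open>x = y\<close>.

  The same argument, read modulo a congruence \<open>\<theta>\<close> instead of equality, shows that
  \<open>(x, y) \<in> \<theta>\<close> if and only if \<open>s_term x y\<close> is in the class of \<open>\<top>\<close>. Hence a congruence is determined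
  by that class (\<open>Theta_class_of_one\<close>), which is readily seen to be an open implicative filter.

  In the other direction, an open implicative filter \<open>F\<close> is a lattice filter, and reading
  \<open>(x \<rightarrow> y) \<in> F\<close> for \<open>x \<preceq> y\<close> again gives a preorder, for which \<open>\<sqinter>\<close> and \<open>\<squnion>\<close> are monotone and
  \<open>\<rightarrow>\<close> is antitone in the first and monotone in the second argument. \<open>Theta F\<close> relates \<open>x\<close> and \<open>y\<close>
  when they are equivalent for this preorder and so are \<open>\<sim> x\<close> and \<open>\<sim> y\<close>. Compatibility with the
  operations must therefore be checked twice, once for the values and once for their negations; for
  \<open>\<rightarrow>\<close> the negated part is what the two axioms identifying \<open>\<sim> (x \<rightarrow> y)\<close> with \<open>x \<sqinter> \<sim> y\<close> up to
  \<open>\<preceq>\<close> provide (\<open>Theta_congruence\<close>). Finally the class of \<open>\<top>\<close> under \<open>Theta F\<close> is \<open>F\<close>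
  (\<open>class_of_one_Theta\<close>). Both assignments are visibly monotone and mutually inverse, hence order
  isomorphisms.
\<close>

section \<open>Arithmetic of subresiduated Nelson algebras\<close>

context kleene_algebra
begin

lemma kneg_sup: "\<sim> (x \<squnion> y) = \<sim> x \<sqinter> \<sim> y"
  by (metis kneg_inf kneg_kneg)

lemma kneg_top: "\<sim> \<top> = \<bottom>"
  by (metis kneg_kneg kneg_sup sup_top_left inf_bot_right)

lemma inf_kneg_le: "x \<sqinter> \<sim> x \<le> y \<squnion> \<sim> y"
  by (metis kleene inf_le2)

end

context subresiduated_nelson_algebra
begin

text \<open>With \<open>\<top>\<close> as the premise, \<open>\<sim> \<top>\<close> vanishes from \<open>inf_nimp_le\<close>. Since \<open>\<top> \<rightarrow> x\<close> may
  be strictly below \<open>x\<close>, openness of a filter is a condition, not a consequence of upward closure.\<close>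

lemma top_nimp_le: "(\<top> \<rightarrow> x) \<le> x"
  using inf_nimp_le[of \<top> x] by (simp add: kneg_top)

lemma nimp_mono: "y \<le> z \<Longrightarrow> (x \<rightarrow> y) \<le> (x \<rightarrow> z)"
  by (metis inf.absorb_iff1 nimp_inf)

lemma nimp_antimono: "x \<le> y \<Longrightarrow> (y \<rightarrow> z) \<le> (x \<rightarrow> z)"
  by (metis sup.absorb2 sup_nimp inf_le1)

lemma nimp_eq_top: "x \<le> y \<Longrightarrow> (x \<rightarrow> y) = \<top>"
  by (metis nimp_mono nimp_refl top_le)

text \<open>\<open>x \<sqinter> \<sim> x\<close> need not be \<open>\<bottom>\<close>, but it is below it for the preorder given by \<open>\<rightarrow>\<close>,
  because it is equivalent to \<open>\<sim> (x \<rightarrow> x) = \<bottom>\<close>.\<close>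

lemma inf_kneg_nimp_bot: "(x \<sqinter> \<sim> x \<rightarrow> \<bottom>) = \<top>"
  using kneg_nimp_2[of x x] by (simp add: nimp_refl kneg_top)

end

section \<open>The class of the top element of a congruence\<close>

lemma mem_class_of_one: "x \<in> class_of_one \<theta> \<longleftrightarrow> (\<top>, x) \<in> \<theta>"
  by (simp add: class_of_one_def)

context
  fixes \<theta> :: "('a::subresiduated_nelson_algebra \<times> 'a) set"
  assumes cong: "\<theta> \<in> congruences"
begin

lemma cong_refl: "(x, x) \<in> \<theta>"
  using cong by (auto simp: congruences_def equiv_def refl_on_def)

lemma cong_sym: "(x, y) \<in> \<theta> \<Longrightarrow> (y, x) \<in> \<theta>"
  using cong by (auto simp: congruences_def equiv_def dest: symD)

lemma cong_trans: "(x, y) \<in> \<theta> \<Longrightarrow> (y, z) \<in> \<theta> \<Longrightarrow> (x, z) \<in> \<theta>"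
  using cong by (auto simp: congruences_def equiv_def dest: transD)

lemma cong_inf: "(x, x') \<in> \<theta> \<Longrightarrow> (y, y') \<in> \<theta> \<Longrightarrow> (x \<sqinter> y, x' \<sqinter> y') \<in> \<theta>"
  using cong by (auto simp: congruences_def)

lemma cong_sup: "(x, x') \<in> \<theta> \<Longrightarrow> (y, y') \<in> \<theta> \<Longrightarrow> (x \<squnion> y, x' \<squnion> y') \<in> \<theta>"
  using cong by (auto simp: congruences_def)

lemma cong_nimp: "(x, x') \<in> \<theta> \<Longrightarrow> (y, y') \<in> \<theta> \<Longrightarrow> (x \<rightarrow> y, x' \<rightarrow> y') \<in> \<theta>"
  using cong by (auto simp: congruences_def)

lemma cong_kneg: "(x, x') \<in> \<theta> \<Longrightarrow> (\<sim> x, \<sim> x') \<in> \<theta>"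
  using cong by (auto simp: congruences_def)

lemma cong_upward:
  assumes "(\<top>, x) \<in> \<theta>" "x \<le> y"
  shows "(\<top>, y) \<in> \<theta>"
  using cong_sup[OF assms(1) cong_refl[of y]] assms(2) by (simp add: sup.absorb2)

text \<open>The class is closed under detachment because in the quotient \<open>\<top> \<rightarrow> y\<close> equals \<open>\<top>\<close> and
  lies below \<open>y\<close>.\<close>

lemma class_of_one_open_filter: "class_of_one \<theta> \<in> open_implicative_filters"
proof -
  have "(\<top>, y) \<in> \<theta>" if x: "(\<top>, x) \<in> \<theta>" and xy: "(\<top>, x \<rightarrow> y) \<in> \<theta>" for x y
  proof -
    have "(x \<rightarrow> y, \<top> \<rightarrow> y) \<in> \<theta>"
      using cong_nimp[OF cong_sym[OF x] cong_refl] .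
    then have "(\<top>, \<top> \<rightarrow> y) \<in> \<theta>"
      using cong_trans[OF xy] by blast
    then show ?thesis
      using cong_upward top_nimp_le by blast
  qed
  moreover have "(\<top>, \<top> \<rightarrow> x) \<in> \<theta>" if "(\<top>, x) \<in> \<theta>" for x
    using cong_nimp[OF cong_refl[of \<top>] that] by (simp add: nimp_refl)
  ultimately show ?thesis
    unfolding open_implicative_filters_def implicative_filter_def
    using cong_refl[of \<top>] unfolding mem_class_of_one mem_Collect_eq Ball_def by blast
qed

text \<open>The axiom \<open>x \<sqinter> (x \<rightarrow> y) \<le> \<sim> x \<squnion> y\<close> simplifies, modulo \<open>\<theta>\<close>, to \<open>x \<le> \<sim> x \<squnion> y\<close>
  when \<open>x \<rightarrow> y\<close> is congruent to \<open>\<top>\<close>.\<close>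

lemma cong_nimp_top:
  assumes "(\<top>, x \<rightarrow> y) \<in> \<theta>"
  shows "(x, x \<sqinter> (\<sim> x \<squnion> y)) \<in> \<theta>"
proof -
  let ?d = "x \<sqinter> (\<sim> x \<squnion> y)"
  have step: "(x, x \<sqinter> (x \<rightarrow> y)) \<in> \<theta>"
    using cong_inf[OF cong_refl[of x] assms] by simp
  have "(x \<sqinter> ?d, (x \<sqinter> (x \<rightarrow> y)) \<sqinter> ?d) \<in> \<theta>"
    using cong_inf[OF step cong_refl] .
  moreover have "(x \<sqinter> (x \<rightarrow> y)) \<sqinter> ?d = x \<sqinter> (x \<rightarrow> y)"
    by (rule inf.absorb1[OF inf_nimp_le])
  moreover have "x \<sqinter> ?d = ?d"
    by (simp add: inf.absorb2)
  ultimately have "(?d, x \<sqinter> (x \<rightarrow> y)) \<in> \<theta>"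
    by metis
  then show ?thesis
    using step cong_sym cong_trans by blast
qed

text \<open>The order of the quotient is detected by implication and negation together. The two
  hypotheses say that, modulo \<open>\<theta>\<close>, \<open>x\<close> is \<open>(x \<sqinter> \<sim> x) \<squnion> (x \<sqinter> y)\<close> and \<open>x \<sqinter> \<sim> y \<le> y\<close>; the Kleene
  law bounds the remaining part \<open>x \<sqinter> \<sim> x\<close> by \<open>y \<squnion> \<sim> y\<close>. Being also below \<open>x\<close>,
  it is below \<open>y\<close>.\<close>

lemma cong_inf_absorb:
  assumes "(\<top>, x \<rightarrow> y) \<in> \<theta>" "(\<top>, \<sim> y \<rightarrow> \<sim> x) \<in> \<theta>"
  shows "(x, x \<sqinter> y) \<in> \<theta>"
proof -
  have 1: "(x, x \<sqinter> (\<sim> x \<squnion> y)) \<in> \<theta>"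
    using cong_nimp_top[OF assms(1)] .
  have "(y, y \<squnion> (\<sim> y \<sqinter> x)) \<in> \<theta>"
    using cong_kneg[OF cong_nimp_top[OF assms(2)]] by (simp add: kneg_kneg kneg_inf kneg_sup)
  from cong_inf[OF cong_refl[of x] this]
  have 2: "(x \<sqinter> y, x \<sqinter> (y \<squnion> \<sim> y)) \<in> \<theta>"
    by (simp add: inf_sup_distrib1 inf_left_commute inf_commute)
  have "x \<sqinter> \<sim> x \<le> x \<sqinter> (y \<squnion> \<sim> y)"
    using inf_kneg_le[of x y] by simp
  moreover have "x \<sqinter> y \<le> x \<sqinter> (y \<squnion> \<sim> y)"
    by (simp add: le_infI2)
  ultimately have "x \<sqinter> (\<sim> x \<squnion> y) \<squnion> x \<sqinter> (y \<squnion> \<sim> y) = x \<sqinter> (y \<squnion> \<sim> y)"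
    by (metis inf_sup_distrib1 le_supI sup.absorb2)
  with cong_sup[OF 1 cong_refl[of "x \<sqinter> (y \<squnion> \<sim> y)"]]
  have "(x, x \<sqinter> (y \<squnion> \<sim> y)) \<in> \<theta>"
    by (simp add: sup.absorb1)
  then show ?thesis
    using cong_trans[OF _ cong_sym[OF 2]] by blast
qed

lemma cong_iff_s_term: "(x, y) \<in> \<theta> \<longleftrightarrow> (\<top>, s_term x y) \<in> \<theta>"
proof
  assume xy: "(x, y) \<in> \<theta>"
  have "(s_term x x, s_term x y) \<in> \<theta>"
    unfolding s_term_def by (intro cong_inf cong_nimp cong_kneg cong_refl xy)
  then show "(\<top>, s_term x y) \<in> \<theta>"
    by (simp add: s_term_def nimp_refl)
next
  assume s: "(\<top>, s_term x y) \<in> \<theta>"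
  have "(\<top>, x \<rightarrow> y) \<in> \<theta>" "(\<top>, \<sim> y \<rightarrow> \<sim> x) \<in> \<theta>" "(\<top>, y \<rightarrow> x) \<in> \<theta>" "(\<top>, \<sim> x \<rightarrow> \<sim> y) \<in> \<theta>"
    by (rule cong_upward[OF s], simp add: s_term_def le_infI1 le_infI2)+
  then have "(x, x \<sqinter> y) \<in> \<theta>" "(y, x \<sqinter> y) \<in> \<theta>"
    using cong_inf_absorb[of x y] cong_inf_absorb[of y x] by (simp_all add: inf_commute)
  then show "(x, y) \<in> \<theta>"
    using cong_sym cong_trans by blast
qed

lemma Theta_class_of_one: "Theta (class_of_one \<theta>) = \<theta>"
  using cong_iff_s_term by (auto simp: Theta_def mem_class_of_one)

end

section \<open>The relation of an open implicative filter\<close>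

context
  fixes F :: "'a::subresiduated_nelson_algebra set"
  assumes filter: "F \<in> open_implicative_filters"
begin

lemma filter_top: "\<top> \<in> F"
  using filter unfolding open_implicative_filters_def implicative_filter_def by blast

lemma filter_detach: "x \<in> F \<Longrightarrow> (x \<rightarrow> y) \<in> F \<Longrightarrow> y \<in> F"
  using filter unfolding open_implicative_filters_def implicative_filter_def by blast

lemma filter_upward: "x \<in> F \<Longrightarrow> x \<le> y \<Longrightarrow> y \<in> F"
  using filter_detach[of x y] by (simp add: nimp_eq_top filter_top)

text \<open>Weakening: openness gives \<open>\<top> \<rightarrow> x\<close> in \<open>F\<close>, and this lies below \<open>y \<rightarrow> x\<close>. It is
  what makes \<open>F\<close> closed under meets.\<close>

lemma filter_weaken: "x \<in> F \<Longrightarrow> (y \<rightarrow> x) \<in> F"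
  by (rule filter_upward[OF _ nimp_antimono[OF top_greatest]])
    (use filter in \<open>simp add: open_implicative_filters_def\<close>)

lemma filter_inf: "x \<sqinter> y \<in> F \<longleftrightarrow> x \<in> F \<and> y \<in> F"
proof
  assume "x \<sqinter> y \<in> F"
  then show "x \<in> F \<and> y \<in> F"
    using filter_upward[OF _ inf_le1] filter_upward[OF _ inf_le2] by blast
next
  assume xy: "x \<in> F \<and> y \<in> F"
  then have "(y \<rightarrow> x \<sqinter> y) \<in> F"
    using filter_weaken by (simp add: nimp_inf nimp_refl)
  with xy show "x \<sqinter> y \<in> F"
    using filter_detach by blast
qed

lemma filter_nimp_of_le: "x \<le> y \<Longrightarrow> (x \<rightarrow> y) \<in> F"
  by (simp add: nimp_eq_top filter_top)

lemma filter_nimp_trans: "(x \<rightarrow> y) \<in> F \<Longrightarrow> (y \<rightarrow> z) \<in> F \<Longrightarrow> (x \<rightarrow> z) \<in> F"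
  using filter_detach[of "(x \<rightarrow> y) \<sqinter> (y \<rightarrow> z)"] by (simp add: filter_inf nimp_trans filter_top)

lemma filter_nimp_inf:
  assumes "(x \<rightarrow> x') \<in> F" "(y \<rightarrow> y') \<in> F"
  shows "(x \<sqinter> y \<rightarrow> x' \<sqinter> y') \<in> F"
  unfolding nimp_inf filter_inf
  using filter_nimp_trans[OF filter_nimp_of_le[OF inf_le1] assms(1)]
    filter_nimp_trans[OF filter_nimp_of_le[OF inf_le2] assms(2)] by blast

lemma filter_nimp_sup:
  assumes "(x \<rightarrow> x') \<in> F" "(y \<rightarrow> y') \<in> F"
  shows "(x \<squnion> y \<rightarrow> x' \<squnion> y') \<in> F"
  unfolding sup_nimp filter_inf
  using filter_nimp_trans[OF assms(1) filter_nimp_of_le[OF sup_ge1]]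
    filter_nimp_trans[OF assms(2) filter_nimp_of_le[OF sup_ge2]] by blast

text \<open>Transitivity of \<open>\<rightarrow>\<close> is available only with both hypotheses conjoined. A missing one
  that belongs to \<open>F\<close> can be supplied, as \<open>F\<close> is closed under weakening.\<close>

lemma filter_nimp_nimp:
  assumes "(x' \<rightarrow> x) \<in> F" "(y \<rightarrow> y') \<in> F"
  shows "((x \<rightarrow> y) \<rightarrow> (x' \<rightarrow> y')) \<in> F"
proof (rule filter_nimp_trans)
  have "((x \<rightarrow> y) \<rightarrow> (x' \<rightarrow> x) \<sqinter> (x \<rightarrow> y)) \<in> F"
    using filter_weaken[OF assms(1)] by (simp add: nimp_inf nimp_refl)
  then show "((x \<rightarrow> y) \<rightarrow> (x' \<rightarrow> y)) \<in> F"
    by (rule filter_nimp_trans) (simp add: nimp_trans filter_top)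
  have "((x' \<rightarrow> y) \<rightarrow> (x' \<rightarrow> y) \<sqinter> (y \<rightarrow> y')) \<in> F"
    using filter_weaken[OF assms(2)] by (simp add: nimp_inf nimp_refl)
  then show "((x' \<rightarrow> y) \<rightarrow> (x' \<rightarrow> y')) \<in> F"
    by (rule filter_nimp_trans) (simp add: nimp_trans filter_top)
qed

lemma filter_kneg_nimp:
  assumes "(x \<rightarrow> x') \<in> F" "(\<sim> y \<rightarrow> \<sim> y') \<in> F"
  shows "(\<sim> (x \<rightarrow> y) \<rightarrow> \<sim> (x' \<rightarrow> y')) \<in> F"
proof (rule filter_nimp_trans)
  show "(\<sim> (x \<rightarrow> y) \<rightarrow> x \<sqinter> \<sim> y) \<in> F"
    by (simp add: kneg_nimp_1 filter_top)
  show "(x \<sqinter> \<sim> y \<rightarrow> \<sim> (x' \<rightarrow> y')) \<in> F"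
    by (rule filter_nimp_trans[OF filter_nimp_inf[OF assms]])
      (simp add: kneg_nimp_2 filter_top)
qed

lemma mem_Theta:
  "(x, y) \<in> Theta F \<longleftrightarrow>
    (x \<rightarrow> y) \<in> F \<and> (y \<rightarrow> x) \<in> F \<and> (\<sim> x \<rightarrow> \<sim> y) \<in> F \<and> (\<sim> y \<rightarrow> \<sim> x) \<in> F"
  by (simp add: Theta_def s_term_def filter_inf)

lemma Theta_congruence: "Theta F \<in> congruences"
proof -
  have "equiv UNIV (Theta F)"
  proof (rule equivI)
    show "refl_on UNIV (Theta F)" "sym (Theta F)"
      by (auto simp: refl_on_def sym_def mem_Theta nimp_refl filter_top)
    show "trans (Theta F)"
      unfolding trans_def mem_Theta using filter_nimp_trans by blast
  qed simp
  moreover have "(x \<sqinter> y, x' \<sqinter> y') \<in> Theta F \<and> (x \<squnion> y, x' \<squnion> y') \<in> Theta F \<and>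
      (x \<rightarrow> y, x' \<rightarrow> y') \<in> Theta F"
    if "(x, x') \<in> Theta F" "(y, y') \<in> Theta F" for x x' y y'
    using that unfolding mem_Theta kneg_inf kneg_sup
    by (simp add: filter_nimp_inf filter_nimp_sup filter_nimp_nimp filter_kneg_nimp)
  moreover have "(\<sim> x, \<sim> x') \<in> Theta F" if "(x, x') \<in> Theta F" for x x'
    using that by (simp add: mem_Theta kneg_kneg)
  ultimately show ?thesis
    by (simp add: congruences_def)
qed

text \<open>Two of the four implications defining \<open>Theta F\<close> between \<open>\<top>\<close> and \<open>x\<close> are trivial, and the
  third is openness. The fourth, \<open>\<sim> x \<rightarrow> \<bottom>\<close>, holds modulo \<open>F\<close> for \<open>x\<close> in \<open>F\<close> because
  weakening gives \<open>\<sim> x \<rightarrow> x\<close>, so that \<open>\<sim> x\<close> implies \<open>x \<sqinter> \<sim> x\<close>, which implies \<open>\<bottom>\<close>.\<close>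

lemma class_of_one_Theta: "class_of_one (Theta F) = F"
proof -
  have "x \<in> F" if "(\<top> \<rightarrow> x) \<in> F" for x
    using that filter_detach filter_top by blast
  moreover have "(\<sim> x \<rightarrow> \<bottom>) \<in> F" if "x \<in> F" for x
  proof (rule filter_nimp_trans)
    show "(\<sim> x \<rightarrow> x \<sqinter> \<sim> x) \<in> F"
      using filter_weaken[OF that] by (simp add: nimp_inf nimp_refl)
    show "(x \<sqinter> \<sim> x \<rightarrow> \<bottom>) \<in> F"
      by (simp add: inf_kneg_nimp_bot filter_top)
  qed
  ultimately show ?thesis
    unfolding set_eq_iff mem_class_of_one mem_Theta kneg_top
    using filter_weaken filter_nimp_of_le[OF top_greatest] filter_nimp_of_le[OF bot_least] by blast
qed

end

section \<open>The order isomorphism\<close>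

lemma class_of_one_mono: "\<theta> \<subseteq> \<theta>' \<Longrightarrow> class_of_one \<theta> \<subseteq> class_of_one \<theta>'"
  by (auto simp: class_of_one_def)

lemma Theta_mono: "F \<subseteq> F' \<Longrightarrow> Theta F \<subseteq> Theta F'"
  by (auto simp: Theta_def)

theorem theorem4p7:
  shows "bij_betw class_of_one
      (congruences :: ('a::subresiduated_nelson_algebra \<times> 'a) set set)
      (open_implicative_filters :: 'a set set) \<and>
    bij_betw Theta (open_implicative_filters :: 'a set set) congruences \<and>
    (\<forall>\<theta>\<in>(congruences :: ('a \<times> 'a) set set). Theta (class_of_one \<theta>) = \<theta>) \<and>
    (\<forall>F\<in>(open_implicative_filters :: 'a set set). class_of_one (Theta F) = F) \<and>
    (\<forall>\<theta>\<in>(congruences :: ('a \<times> 'a) set set). \<forall>\<theta>'\<in>congruences.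
       \<theta> \<subseteq> \<theta>' \<longleftrightarrow> class_of_one \<theta> \<subseteq> class_of_one \<theta>') \<and>
    (\<forall>F\<in>(open_implicative_filters :: 'a set set). \<forall>F'\<in>open_implicative_filters.
       F \<subseteq> F' \<longleftrightarrow> Theta F \<subseteq> Theta F')"
proof (intro conjI ballI)
  show "bij_betw class_of_one (congruences :: ('a \<times> 'a) set set) open_implicative_filters"
    by (rule bij_betw_byWitness[where f' = Theta])
      (auto simp: Theta_class_of_one class_of_one_Theta class_of_one_open_filter Theta_congruence)
  show "bij_betw Theta (open_implicative_filters :: 'a set set) congruences"
    by (rule bij_betw_byWitness[where f' = class_of_one])
      (auto simp: Theta_class_of_one class_of_one_Theta class_of_one_open_filter Theta_congruence)
next
  fix \<theta> :: "('a \<times> 'a) set"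
  assume "\<theta> \<in> congruences"
  then show "Theta (class_of_one \<theta>) = \<theta>"
    by (rule Theta_class_of_one)
next
  fix F :: "'a set"
  assume "F \<in> open_implicative_filters"
  then show "class_of_one (Theta F) = F"
    by (rule class_of_one_Theta)
next
  fix \<theta> \<theta>' :: "('a \<times> 'a) set"
  assume "\<theta> \<in> congruences" "\<theta>' \<in> congruences"
  then show "\<theta> \<subseteq> \<theta>' \<longleftrightarrow> class_of_one \<theta> \<subseteq> class_of_one \<theta>'"
    by (metis Theta_class_of_one Theta_mono class_of_one_mono)
next
  fix F F' :: "'a set"
  assume "F \<in> open_implicative_filters" "F' \<in> open_implicative_filters"
  then show "F \<subseteq> F' \<longleftrightarrow> Theta F \<subseteq> Theta F'"
    by (metis class_of_one_Theta class_of_one_mono Theta_mono)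
qed

end
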